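(* Let $f_1,\dots,f_N:\mathbb{R}^d\to\mathbb{R}$ be differentiable, let $F=\frac1N\sum_{i=1}^N f_i$, and let $\{x^{(k)}\}_{k\ge 0}$ be a sequence of iterates of the stochastic gradient method $x^{(k+1)}=x^{(k)}-\alpha_k\nabla_{S_k}F(x^{(k)})$ in which each batch $S_k=S_k^{(n)}$ is drawn by sampling without replacement, with batch size $N_S$ satisfying $1\le N_S<N$ ($N_S$ may depend on $k$). Then for every $k\ge 0$ the gradient batch estimate satisfies, almost surely, $$\mathrm{E}_k\big[\nabla_{S_k^{(n)}}F(x^{(k)})\big]=\mathrm{E}\big[\nabla_{S_k^{(n)}}F(x^{(k)})\big]=\nabla F(x^{(k)})$$ and $$\mathrm{Var}_k\big[\nabla_{S_k^{(n)}}F(x^{(k)})\big]=\mathrm{E}\big[\|\nabla_{S_k^{(n)}}F(x^{(k)})-\nabla F(x^{(k)})\|^2\big]=\frac{\mathrm{Var}[\nabla f_\imath(x^{(k)})]}{N_S}\cdot\frac{N-N_S}{N-1}.$$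
   Context: For a subset $S\subseteq\{1,\dots,N\}$ of size $N_S$ and $x\in\mathbb{R}^d$, the gradient batch estimate is $\nabla_S F(x)=\frac1{N_S}\sum_{i\in S}\nabla f_i(x)$; also $\nabla F(x)=\frac1N\sum_{i=1}^N\nabla f_i(x)$. The numbers $\alpha_k\in\mathbb{R}$ are the learning rates, and $\|\cdot\|$ is the Euclidean norm. Sampling without replacement: the batch $S_k^{(n)}$ consists of $N_S$ distinct indices selected simultaneously, and the sampling distribution is uniform over the $\binom{N}{N_S}$ subsets of $\{1,\dots,N\}$ of size $N_S$. The random draw of $S_k^{(n)}$ happens after $x^{(k)}$ is fixed: letting $\mathcal{F}_k$ be the sigma-algebra generated by $x^{(0)},\dots,x^{(k)}$, the conditional distribution of $S_k^{(n)}$ given $\mathcal{F}_k$ is this uniform distribution. $\mathrm{E}_k$ denotes conditional expectation with respect to $\mathcal{F}_k$ (computed with the conditional distribution of $S_k^{(n)}$ given $\mathcal{F}_k$), and $\mathrm{Var}_k[\nabla_{S_k^{(n)}}F(x^{(k)})]=\mathrm{E}_k[\|\nabla_{S_k^{(n)}}F(x^{(k)})-\nabla F(x^{(k)})\|^2]$. $\mathrm{E}$ denotes expectation with respect to the discrete measure induced only by the random choice of the batch, with $x^{(k)}$ held fixed; that is, for a function $g$ of the batch and the point, $\mathrm{E}[g(S_k^{(n)},x^{(k)})]=\binom{N}{N_S}^{-1}\sum_{S\subseteq\{1,\dots,N\},\,|S|=N_S} g(S,x^{(k)})$. The variance of the individual component gradients at $x\in\mathbb{R}^d$ is $\mathrm{Var}[\nabla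 f_\imath(x)]=\frac1N\sum_{i=1}^N\|\nabla f_i(x)-\nabla F(x)\|^2$. *)

theory Defs
  imports "HOL-Probability.Probability"
begin

definition gradient :: "('a::real_inner \<Rightarrow> real) \<Rightarrow> 'a \<Rightarrow> 'a"
  where "gradient f y = (THE D. GDERIV f y :> D)"

lemma GDERIV_unique:
  assumes "GDERIV f y :> D" "GDERIV f y :> D'"
  shows "D = D'"
proof -
  have "(\<lambda>h. h \<bullet> D) = (\<lambda>h. h \<bullet> D')"
    using assms unfolding gderiv_def by (rule has_derivative_unique)
  then have "h \<bullet> D = h \<bullet> D'" for h
    by meson
  then show ?thesis
    by (metis vector_eq_ldot)
qed

lemma gradient_eqI: "GDERIV f y :> D \<Longrightarrow> gradient f y = D"
  unfolding gradient_def by (blast intro: the_equality GDERIV_unique)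

lemma GDERIV_gradient:
  fixes f :: "'a::euclidean_space \<Rightarrow> real"
  assumes "f differentiable (at y)"
  shows "GDERIV f y :> gradient f y"
proof -
  obtain L where L: "(f has_derivative L) (at y)"
    using assms unfolding differentiable_def by blast
  then have "bounded_linear L"
    by (rule has_derivative_bounded_linear)
  then have "linear L"
    by (rule bounded_linear.linear)
  have "L h = h \<bullet> (\<Sum>b\<in>Basis. L b *\<^sub>R b)" for h
  proof -
    have "L h = L (\<Sum>b\<in>Basis. (h \<bullet> b) *\<^sub>R b)"
      by (simp add: euclidean_representation)
    also have "\<dots> = (\<Sum>b\<in>Basis. (h \<bullet> b) * L b)"
      using \<open>linear L\<close> by (simp add: linear_sum linear_cmul)
    finally show ?thesis
      by (simp add: inner_sum_right mult.commute)
  qed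
  then have "L = (\<lambda>h. h \<bullet> (\<Sum>b\<in>Basis. L b *\<^sub>R b))" ..
  with L have "GDERIV f y :> (\<Sum>b\<in>Basis. L b *\<^sub>R b)"
    unfolding gderiv_def by metis
  then show ?thesis
    by (simp add: gradient_eqI)
qed

definition objective :: "nat \<Rightarrow> (nat \<Rightarrow> 'a \<Rightarrow> real) \<Rightarrow> 'a \<Rightarrow> real"
  where "objective N f y = (1 / real N) * (\<Sum>i=1..N. f i y)"

lemma gradient_objective:
  fixes f :: "nat \<Rightarrow> 'a::euclidean_space \<Rightarrow> real"
  assumes "\<And>i. i \<in> {1..N} \<Longrightarrow> f i differentiable (at y)"
  shows "gradient (objective N f) y = (1 / real N) *\<^sub>R (\<Sum>i=1..N. gradient (f i) y)"
proof (rule gradient_eqI)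
  have "((\<lambda>z. f i z) has_derivative (\<lambda>h. h \<bullet> gradient (f i) y)) (at y)" if "i \<in> {1..N}" for i
    using GDERIV_gradient[OF assms[OF that]] by (simp add: gderiv_def)
  then have "((\<lambda>z. (1 / real N) * (\<Sum>i=1..N. f i z)) has_derivative
      (\<lambda>h. (1 / real N) * (\<Sum>i=1..N. h \<bullet> gradient (f i) y))) (at y)"
    by (intro has_derivative_mult_right has_derivative_sum)
  then show "GDERIV (objective N f) y :> (1 / real N) *\<^sub>R (\<Sum>i=1..N. gradient (f i) y)"
    by (simp add: gderiv_def objective_def[abs_def] inner_sum_right)
qed

definition batch_gradient :: "(nat \<Rightarrow> 'a::real_inner \<Rightarrow> real) \<Rightarrow> nat set \<Rightarrow> 'a \<Rightarrow> 'a"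
  where "batch_gradient f B y = (1 / real (card B)) *\<^sub>R (\<Sum>i\<in>B. gradient (f i) y)"

definition component_variance :: "nat \<Rightarrow> (nat \<Rightarrow> 'a::real_inner \<Rightarrow> real) \<Rightarrow> 'a \<Rightarrow> real"
  where "component_variance N f y =
    (1 / real N) * (\<Sum>i=1..N. (norm (gradient (f i) y - gradient (objective N f) y))\<^sup>2)"

definition batches :: "nat \<Rightarrow> nat \<Rightarrow> nat set set"
  where "batches N n = {B. B \<subseteq> {1..N} \<and> card B = n}"

text \<open>Expectation over the uniform choice of the batch alone, the point being held fixed.\<close>

definition batch_expectation :: "nat \<Rightarrow> nat \<Rightarrow> (nat set \<Rightarrow> 'v::real_vector) \<Rightarrow> 'v"
  where "batch_expectation N n g = (1 / real (N choose n)) *\<^sub>R (\<Sum>B\<in>batches N n. g B)"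

text \<open>The sigma-algebra generated by \<open>x 0, \<dots>, x k\<close>.\<close>

definition history :: "'w measure \<Rightarrow> (nat \<Rightarrow> 'w \<Rightarrow> 'a::topological_space) \<Rightarrow> nat \<Rightarrow> 'w measure"
  where "history M x k = sigma (space M) {x j -` A \<inter> space M | j A. j \<le> k \<and> A \<in> sets borel}"

text \<open>
  The library's conditional expectation is scalar, so that of a random vector is taken
  coordinatewise. \<^const>\<open>real_cond_exp\<close> is the difference of the conditional expectations of the
  positive and the negative part, so it is meaningful as soon as these are almost surely finite,
  even for a variable that is not integrable.
\<close>

definition vec_cond_exp ::
    "'w measure \<Rightarrow> 'w measure \<Rightarrow> ('w \<Rightarrow> real ^ 'd) \<Rightarrow> 'w \<Rightarrow> real ^ 'd"
  where "vec_cond_exp M G X \<omega> = (\<chi> j. real_cond_exp M G (\<lambda>\<omega>'. X \<omega>' $ j) \<omega>)"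

text \<open>
  The centre \<open>Y\<close> is an argument: that it is the conditional mean of \<open>X\<close> is a claim to prove, not
  part of the definition.
\<close>

definition cond_variance_about ::
    "'w measure \<Rightarrow> 'w measure \<Rightarrow> ('w \<Rightarrow> 'a::real_normed_vector) \<Rightarrow> ('w \<Rightarrow> 'a) \<Rightarrow> 'w \<Rightarrow> real"
  where "cond_variance_about M G X Y = real_cond_exp M G (\<lambda>\<omega>. (norm (X \<omega> - Y \<omega>))\<^sup>2)"

text \<open>
  Conditionally on \<open>G\<close>, the random batch \<open>T\<close> is uniformly distributed over the subsets of
  \<open>{1..N}\<close> of size \<open>n\<close>. The conditional distribution, living on a finite set, is given by its
  point masses.
\<close>

definition cond_uniform_batch ::
    "'w measure \<Rightarrow> 'w measure \<Rightarrow> nat \<Rightarrow> nat \<Rightarrow> ('w \<Rightarrow> nat set) \<Rightarrow> bool"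
  where "cond_uniform_batch M G N n T \<longleftrightarrow>
    T \<in> measurable M (count_space (batches N n)) \<and>
    (\<forall>B\<in>batches N n. AE \<omega> in M.
       real_cond_exp M G (indicator {\<omega> \<in> space M. T \<omega> = B}) \<omega> = 1 / real (N choose n))"

end

theory Submission
  imports Defs
begin

text \<open>
  Given the history, \<open>x k\<close> is known and the batch takes finitely many values, so a function of both
  is a finite sum of known functions times indicators of batch values, whose conditional
  expectations are constant: conditioning amounts to averaging over batches. This requires the
  iterates, hence the gradients, to be Borel; the latter are pointwise limits of difference
  quotients. The averages follow by counting the batches that contain \<open>i\<close>, and those that contain
  \<open>i\<close> but not \<open>j\<close>.
\<close>

section \<open>Averages over batches\<close>

text \<open>Deleting \<open>I\<close> from \<open>B\<close> leaves an arbitrary subset of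
  \<open>A - I - J\<close> of size \<open>n - card I\<close>. If \<open>card I\<close> exceeded
  \<open>n\<close>, the truncated difference would make the right-hand side 1, although no such
  \<open>B\<close> exists.\<close>

lemma card_subsets_containing_avoiding:
  assumes "finite A" "I \<subseteq> A" "J \<subseteq> A" "I \<inter> J = {}" "card I \<le> n"
  shows "card {B. B \<subseteq> A \<and> card B = n \<and> I \<subseteq> B \<and> B \<inter> J = {}}
    = (card A - card I - card J) choose (n - card I)"
proof -
  have fin: "finite I" "finite J" "finite (A - I - J)"
    using assms finite_subset by auto
  have "bij_betw (\<lambda>B. B \<union> I) {B. B \<subseteq> A - I - J \<and> card B = n - card I}
      {B. B \<subseteq> A \<and> card B = n \<and> I \<subseteq> B \<and> B \<inter> J = {}}"
  proof (rule bij_betw_byWitness[where f' = "\<lambda>B. B - I"])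
    have "card (B \<union> I) = n" if "B \<subseteq> A - I - J" "card B = n - card I" for B
      using that assms(5) fin finite_subset[OF that(1)] by (subst card_Un_disjoint) auto
    then show "(\<lambda>B. B \<union> I) ` {B. B \<subseteq> A - I - J \<and> card B = n - card I}
        \<subseteq> {B. B \<subseteq> A \<and> card B = n \<and> I \<subseteq> B \<and> B \<inter> J = {}}"
      using assms by auto
    show "(\<lambda>B. B - I) ` {B. B \<subseteq> A \<and> card B = n \<and> I \<subseteq> B \<and> B \<inter> J = {}}
        \<subseteq> {B. B \<subseteq> A - I - J \<and> card B = n - card I}"
      using fin by (auto simp: card_Diff_subset)
  qed auto
  then have "card {B. B \<subseteq> A \<and> card B = n \<and> I \<subseteq> B \<and> B \<inter> J = {}}
      = card (A - I - J) choose (n - card I)"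
    using bij_betw_same_card n_subsets[OF fin(3)] by fastforce
  moreover have "card (A - I - J) = card A - card I - card J"
  proof -
    have "J \<subseteq> A - I"
      using assms by auto
    with assms fin show ?thesis
      by (simp add: card_Diff_subset)
  qed
  ultimately show ?thesis by simp
qed

lemma finite_batches [simp]: "finite (batches N n)"
  unfolding batches_def by (rule finite_subset[of _ "Pow {1..N}"]) auto

lemma card_batches_containing:
  assumes "i \<in> {1..N}" "1 \<le> n"
  shows "card {B \<in> batches N n. i \<in> B} = (N - 1) choose (n - 1)"
proof -
  have "{B \<in> batches N n. i \<in> B}
      = {B. B \<subseteq> {1..N} \<and> card B = n \<and> {i} \<subseteq> B \<and> B \<inter> {} = {}}"
    by (auto simp: batches_def)
  then show ?thesis
    using card_subsets_containing_avoiding[of "{1..N}" "{i}" "{}" n] assms by simp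
qed

lemma card_batches_separating:
  assumes "i \<in> {1..N}" "j \<in> {1..N}" "i \<noteq> j" "1 \<le> n"
  shows "card {B \<in> batches N n. i \<in> B \<and> j \<notin> B} = (N - 2) choose (n - 1)"
proof -
  have "{B \<in> batches N n. i \<in> B \<and> j \<notin> B}
      = {B. B \<subseteq> {1..N} \<and> card B = n \<and> {i} \<subseteq> B \<and> B \<inter> {j} = {}}"
    by (auto simp: batches_def)
  then show ?thesis
    using card_subsets_containing_avoiding[of "{1..N}" "{i}" "{j}" n] assms
    by (simp add: numeral_2_eq_2)
qed

text \<open>Extension by zero gives all batches the same index range, so that sums over batches and
  sums over indices can be exchanged.\<close>

lemma sum_restrict_subset:
  assumes "finite A" "B \<subseteq> A"
  shows "sum v B = (\<Sum>i\<in>A. if i \<in> B then v i else 0)"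
  using assms by (simp add: sum.inter_restrict[symmetric] Int_absorb1)

text \<open>Double counting: \<open>v i\<close> occurs once for every batch containing
  \<open>i\<close>, and the number of these batches is the same for all \<open>i\<close>.\<close>

lemma sum_batches:
  fixes v :: "nat \<Rightarrow> 'v::real_vector"
  assumes "1 \<le> n"
  shows "(\<Sum>B\<in>batches N n. \<Sum>i\<in>B. v i) = real ((N - 1) choose (n - 1)) *\<^sub>R (\<Sum>i=1..N. v i)"
proof -
  have "(\<Sum>B\<in>batches N n. \<Sum>i\<in>B. v i)
      = (\<Sum>B\<in>batches N n. \<Sum>i=1..N. if i \<in> B then v i else 0)"
    by (intro sum.cong[OF refl] sum_restrict_subset) (auto simp: batches_def)
  also have "\<dots> = (\<Sum>i=1..N. \<Sum>B\<in>batches N n. if i \<in> B then v i else 0)"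
    by (rule sum.swap)
  also have "\<dots> = (\<Sum>i=1..N. real (card {B \<in> batches N n. i \<in> B}) *\<^sub>R v i)"
    by (simp add: sum.inter_filter[symmetric] sum_constant_scaleR)
  also have "\<dots> = (\<Sum>i=1..N. real ((N - 1) choose (n - 1)) *\<^sub>R v i)"
    using assms by (intro sum.cong) (auto simp: card_batches_containing simp del: atLeastAtMost_iff)
  finally show ?thesis
    by (simp add: scaleR_sum_right)
qed

text \<open>
  As the \<open>v i\<close> sum to zero, the sum over \<open>B\<close> is the negative of the sum over its complement;
  only pairs separated by \<open>B\<close> occur then, so that \<open>n = 1\<close> needs no special treatment.
\<close>

lemma sum_batches_norm_squared:
  fixes v :: "nat \<Rightarrow> 'v::real_inner"
  assumes "1 \<le> n" and zero: "(\<Sum>i=1..N. v i) = 0"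
  shows "(\<Sum>B\<in>batches N n. (norm (\<Sum>i\<in>B. v i))\<^sup>2)
    = real ((N - 2) choose (n - 1)) * (\<Sum>i=1..N. (norm (v i))\<^sup>2)"
proof -
  define c where "c = real ((N - 2) choose (n - 1))"
  have "(norm (\<Sum>i\<in>B. v i))\<^sup>2
      = - (\<Sum>i=1..N. \<Sum>j=1..N. if i \<in> B \<and> j \<notin> B then v i \<bullet> v j else 0)"
    if "B \<in> batches N n" for B
  proof -
    have B: "B \<subseteq> {1..N}"
      using that by (simp add: batches_def)
    have "(\<Sum>i=1..N. v i) = (\<Sum>i\<in>{1..N} - B. v i) + (\<Sum>i\<in>B. v i)"
      by (rule sum.subset_diff) (use B in auto)
    with zero have "(\<Sum>i\<in>B. v i) = - (\<Sum>j\<in>{1..N} - B. v j)"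
      by (simp add: eq_neg_iff_add_eq_0 add.commute)
    then have "(norm (\<Sum>i\<in>B. v i))\<^sup>2 = - ((\<Sum>i\<in>B. v i) \<bullet> (\<Sum>j\<in>{1..N} - B. v j))"
      by (metis inner_minus_right power2_norm_eq_inner)
    moreover have "(\<Sum>i\<in>B. v i) = (\<Sum>i=1..N. if i \<in> B then v i else 0)"
      using B by (intro sum_restrict_subset) auto
    moreover have "(\<Sum>j\<in>{1..N} - B. v j) = (\<Sum>j=1..N. if j \<notin> B then v j else 0)"
      by (subst sum_restrict_subset[of "{1..N}"]) (auto intro!: sum.cong)
    moreover have "(\<Sum>i=1..N. if i \<in> B then v i else 0) \<bullet> (\<Sum>j=1..N. if j \<notin> B then v j else 0)
        = (\<Sum>i=1..N. \<Sum>j=1..N. if i \<in> B \<and> j \<notin> B then v i \<bullet> v j else 0)"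
      unfolding inner_sum_left unfolding inner_sum_right by (intro sum.cong refl) auto
    ultimately show ?thesis
      by simp
  qed
  then have "(\<Sum>B\<in>batches N n. (norm (\<Sum>i\<in>B. v i))\<^sup>2)
      = - (\<Sum>B\<in>batches N n. \<Sum>i=1..N. \<Sum>j=1..N. if i \<in> B \<and> j \<notin> B then v i \<bullet> v j else 0)"
    by (simp add: sum_negf)
  \<comment> \<open>Two swaps move the sum over \<open>B\<close> innermost, where it counts the
    batches that contain \<open>i\<close> but not \<open>j\<close>. The second swap acts below the
    sum over \<open>i\<close>, hence the occurrence number 2.\<close>
  also have "\<dots> = - (\<Sum>i=1..N. \<Sum>B\<in>batches N n. \<Sum>j=1..N. if i \<in> B \<and> j \<notin> B then v i \<bullet> v j else 0)"
    by (subst sum.swap) (rule refl)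
  also have "\<dots> = - (\<Sum>i=1..N. \<Sum>j=1..N. \<Sum>B\<in>batches N n. if i \<in> B \<and> j \<notin> B then v i \<bullet> v j else 0)"
    by (subst (2) sum.swap) (rule refl)
  also have "\<dots> = - (\<Sum>i=1..N. \<Sum>j=1..N. real (card {B \<in> batches N n. i \<in> B \<and> j \<notin> B}) * (v i \<bullet> v j))"
    by (simp add: sum.inter_filter[symmetric])
  \<comment> \<open>The count is \<open>c\<close> off the diagonal and 0 on it, as no batch
    separates \<open>i\<close> from itself. Completing each row by its diagonal term makes the row
    proportional to the total sum of the \<open>v j\<close>, which vanishes; only the subtracted
    diagonal remains.\<close>
  also have "\<dots> = - (\<Sum>i=1..N. \<Sum>j=1..N. c * (v i \<bullet> v j) - (if j = i then c * (v i \<bullet> v i) else 0))"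
    using assms(1)
    by (intro arg_cong[where f = uminus] sum.cong refl)
      (auto simp: card_batches_separating c_def simp del: atLeastAtMost_iff)
  also have "\<dots> = - (\<Sum>i=1..N. c * (v i \<bullet> (\<Sum>j=1..N. v j)) - c * (v i \<bullet> v i))"
    by (intro arg_cong[where f = uminus] sum.cong refl)
      (simp add: sum_subtractf inner_sum_right sum_distrib_left)
  also have "\<dots> = c * (\<Sum>i=1..N. (norm (v i))\<^sup>2)"
    unfolding zero by (simp add: sum_negf sum_distrib_left power2_norm_eq_inner)
  finally show ?thesis
    by (simp add: c_def)
qed

section \<open>Mean and variance of the gradient batch estimate at a fixed point\<close>

lemma batch_expectation_batch_gradient:
  fixes f :: "nat \<Rightarrow> 'a::euclidean_space \<Rightarrow> real"
  assumes "\<And>i. i \<in> {1..N} \<Longrightarrow> f i differentiable (at y)" and n: "1 \<le> n" "n \<le> N"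
  shows "batch_expectation N n (\<lambda>B. batch_gradient f B y) = gradient (objective N f) y"
proof -
  have "(\<Sum>B\<in>batches N n. batch_gradient f B y)
      = (1 / real n) *\<^sub>R (\<Sum>B\<in>batches N n. \<Sum>i\<in>B. gradient (f i) y)"
    unfolding scaleR_sum_right[of _ _ "batches N n"]
    by (intro sum.cong) (auto simp: batch_gradient_def batches_def)
  also have "\<dots> = (real ((N - 1) choose (n - 1)) / real n) *\<^sub>R (\<Sum>i=1..N. gradient (f i) y)"
    using n by (simp add: sum_batches)
  finally have "batch_expectation N n (\<lambda>B. batch_gradient f B y)
      = (real ((N - 1) choose (n - 1)) / (real n * real (N choose n))) *\<^sub>R (\<Sum>i=1..N. gradient (f i) y)"
    by (simp add: batch_expectation_def mult.commute)
  \<comment> \<open>By absorption the coefficient becomes \<open>1 / real N\<close>, once the common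
    binomial, shown nonzero next, is cancelled.\<close>
  moreover have "real n * real (N choose n) = real N * real ((N - 1) choose (n - 1))"
    using times_binomial_minus1_eq[of n N] n by (metis of_nat_mult less_eq_Suc_le One_nat_def)
  moreover have "(N - 1) choose (n - 1) \<noteq> 0"
    using n by simp
  moreover have "gradient (objective N f) y = (1 / real N) *\<^sub>R (\<Sum>i=1..N. gradient (f i) y)"
    by (rule gradient_objective) (rule assms(1))
  ultimately show ?thesis
    by simp
qed

text \<open>Two absorptions: \<open>n * (N choose n)\<close> equals \<open>N\<close> times
  \<open>(N - 1) choose (n - 1)\<close>, and \<open>N - n\<close> times the latter equals
  \<open>N - 1\<close> times \<open>(N - 2) choose (n - 1)\<close>. This is the origin of the finite
  population factor \<open>(N - n) / (N - 1)\<close>.\<close>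

lemma binomial_variance_factor:
  assumes "1 \<le> n" "n < N"
  shows "real ((N - 2) choose (n - 1)) * (real N * (real N - 1))
    = real n * (real N - real n) * real (N choose n)"
proof -
  \<comment> \<open>Writing \<open>n = m + 1\<close> and \<open>N = m + k + 2\<close> removes all
    truncated subtractions; then \<open>N - n = k + 1\<close>.\<close>
  obtain m where m: "n = Suc m"
    using assms(1) by (cases n) auto
  obtain k where k: "N = Suc (Suc (m + k))"
    using assms(2) m less_imp_Suc_add[of "Suc m" N] by auto
  have "Suc m * (N choose Suc m) = N * (Suc (m + k) choose m)"
    using binomial_absorption[of m N] k by simp
  moreover have "Suc k * (Suc (m + k) choose m) = Suc (m + k) * ((m + k) choose m)"
    using binomial_absorb_comp[of "Suc (m + k)" m] by (simp add: Suc_diff_le)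
  ultimately have "Suc k * (Suc m * (N choose Suc m)) = N * (Suc (m + k) * ((m + k) choose m))"
    by (metis mult.left_commute)
  then have "real (Suc k) * (real (Suc m) * real (N choose Suc m))
      = real N * (real (Suc (m + k)) * real ((m + k) choose m))"
    by (metis of_nat_mult)
  then show ?thesis
    using m k by (simp add: algebra_simps)
qed

text \<open>The deviations \<open>v i\<close> of the component gradients from their mean sum to
  zero, so \<open>sum_batches_norm_squared\<close> applies to them; the rest is the binomial
  identity above.\<close>

lemma batch_expectation_variance:
  fixes f :: "nat \<Rightarrow> 'a::euclidean_space \<Rightarrow> real"
  assumes "\<And>i. i \<in> {1..N} \<Longrightarrow> f i differentiable (at y)" and n: "1 \<le> n" "n < N"
  shows "batch_expectation N n (\<lambda>B. (norm (batch_gradient f B y - gradient (objective N f) y))\<^sup>2)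
    = component_variance N f y / real n * ((real N - real n) / (real N - 1))"
proof -
  define v where "v i = gradient (f i) y - gradient (objective N f) y" for i
  define V where "V = (\<Sum>i=1..N. (norm (v i))\<^sup>2)"
  define c where "c = real ((N - 2) choose (n - 1))"
  have "gradient (objective N f) y = (1 / real N) *\<^sub>R (\<Sum>i=1..N. gradient (f i) y)"
    by (rule gradient_objective) (rule assms(1))
  then have "(\<Sum>i=1..N. gradient (f i) y) = real N *\<^sub>R gradient (objective N f) y"
    using n by simp
  then have zero: "(\<Sum>i=1..N. v i) = 0"
    by (simp add: v_def sum_subtractf sum_constant_scaleR)
  have "(norm (batch_gradient f B y - gradient (objective N f) y))\<^sup>2
      = (1 / (real n)\<^sup>2) * (norm (\<Sum>i\<in>B. v i))\<^sup>2" if "B \<in> batches N n" for B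
  proof -
    have "card B = n"
      using that by (simp add: batches_def)
    \<comment> \<open>A batch has exactly \<open>n\<close> elements, so subtracting the mean from
      the batch average amounts to averaging the deviations.\<close>
    with n have "batch_gradient f B y - gradient (objective N f) y = (1 / real n) *\<^sub>R (\<Sum>i\<in>B. v i)"
      by (simp add: batch_gradient_def v_def sum_subtractf sum_constant_scaleR scaleR_diff_right)
    then show ?thesis
      by (simp add: power_divide)
  qed
  then have "(\<Sum>B\<in>batches N n. (norm (batch_gradient f B y - gradient (objective N f) y))\<^sup>2)
      = (1 / (real n)\<^sup>2) * (c * V)"
    by (simp only: sum_distrib_left[symmetric] sum_batches_norm_squared[OF n(1) zero] V_def c_def
        cong: sum.cong)
  then have "batch_expectation N n (\<lambda>B. (norm (batch_gradient f B y - gradient (objective N f) y))\<^sup>2)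
      = c * V / ((real n)\<^sup>2 * real (N choose n))"
    by (simp add: batch_expectation_def)
  also have "\<dots> = V / real N / real n * ((real N - real n) / (real N - 1))"
  proof -
    have "c * (real N * (real N - 1)) = real n * (real N - real n) * real (N choose n)"
      unfolding c_def by (rule binomial_variance_factor) (use n in auto)
    \<comment> \<open>The division is legitimate because \<open>1 \<le> n < N\<close> forces
      \<open>N \<ge> 2\<close>.\<close>
    then have "c = real n * (real N - real n) * real (N choose n) / (real N * (real N - 1))"
      using n by (simp add: eq_divide_eq)
    moreover have "N choose n \<noteq> 0"
      using n by simp
    ultimately show ?thesis
      using n by (simp add: power2_eq_square mult_ac)
  qed
  also have "V / real N = component_variance N f y"
    by (simp add: component_variance_def V_def v_def)
  finally show ?thesis .
qed

section \<open>Measurability of gradients\<close>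

text \<open>The gradient may be discontinuous, but each of its coordinates is the limit of
  difference quotients, and these are Borel since \<open>f\<close> is continuous.\<close>

lemma borel_measurable_gradient:
  fixes f :: "'a::euclidean_space \<Rightarrow> real"
  assumes diff: "\<And>y. f differentiable (at y)"
  shows "gradient f \<in> borel_measurable borel"
  unfolding borel_measurable_euclidean_space[where 'c = 'a]
proof
  fix b :: 'a assume "b \<in> Basis"
  have "continuous_on UNIV f"
    using diff by (auto intro: differentiable_imp_continuous_on simp: differentiable_on_def)
  then have [measurable]: "f \<in> borel_measurable borel"
    by (rule borel_measurable_continuous_onI)
  define u where "u m y = (f (y + (1 / real (Suc m)) *\<^sub>R b) - f y) / (1 / real (Suc m))" for m y
  show "(\<lambda>y. gradient f y \<bullet> b) \<in> borel_measurable borel"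
  proof (rule borel_measurable_LIMSEQ_real[where u = u])
    show "u m \<in> borel_measurable borel" for m
      unfolding u_def by measurable
    fix y
    \<comment> \<open>The base point is written as \<open>y + 0 *\<^sub>R b\<close> to fit the chain
      rule along the line through \<open>y\<close> in direction \<open>b\<close>.\<close>
    have "(f has_derivative (\<lambda>h. h \<bullet> gradient f y)) (at (y + 0 *\<^sub>R b))"
      using GDERIV_gradient[OF diff] by (simp add: gderiv_def)
    moreover have "((\<lambda>t. y + t *\<^sub>R b) has_derivative (\<lambda>t. t *\<^sub>R b)) (at (0::real))"
      by (auto intro!: derivative_eq_intros)
    ultimately have "((\<lambda>t. f (y + t *\<^sub>R b)) has_derivative (\<lambda>t. (t *\<^sub>R b) \<bullet> gradient f y)) (at 0)"
      by (rule has_derivative_compose[rotated])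
    then have "((\<lambda>t. f (y + t *\<^sub>R b)) has_field_derivative gradient f y \<bullet> b) (at 0)"
      by (simp add: has_field_derivative_def inner_commute mult_commute_abs)
    then have "(\<lambda>t. (f (y + t *\<^sub>R b) - f y) / t) \<midarrow>0\<rightarrow> gradient f y \<bullet> b"
      by (simp add: DERIV_def)
    \<comment> \<open>The filter \<open>at 0\<close> excludes 0 itself, so the steps must tend to 0
      without vanishing; \<open>Suc m\<close> ensures this from \<open>m = 0\<close> on.\<close>
    moreover have "filterlim (\<lambda>m. 1 / real (Suc m)) (at 0) sequentially"
      using LIMSEQ_inverse_real_of_nat by (intro filterlim_atI) (auto simp: inverse_eq_divide)
    ultimately show "(\<lambda>m. u m y) \<longlonglongrightarrow> gradient f y \<bullet> b"
      unfolding u_def by (rule filterlim_compose)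
  qed
qed

lemma borel_measurable_batch_gradient:
  fixes f :: "nat \<Rightarrow> 'a::euclidean_space \<Rightarrow> real"
  assumes "\<And>i y. i \<in> {1..N} \<Longrightarrow> f i differentiable (at y)" "B \<in> batches N n"
  shows "batch_gradient f B \<in> borel_measurable borel"
proof -
  have "gradient (f i) \<in> borel_measurable borel" if "i \<in> B" for i
    using that assms by (auto intro!: borel_measurable_gradient simp: batches_def)
  then show ?thesis
    unfolding batch_gradient_def[abs_def]
    by (intro borel_measurable_scaleR borel_measurable_sum borel_measurable_const)
qed

lemma borel_measurable_gradient_objective:
  fixes f :: "nat \<Rightarrow> 'a::euclidean_space \<Rightarrow> real"
  assumes "\<And>i y. i \<in> {1..N} \<Longrightarrow> f i differentiable (at y)"
  shows "gradient (objective N f) \<in> borel_measurable borel"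
proof (rule borel_measurable_gradient)
  show "objective N f differentiable (at y)" for y
    unfolding objective_def[abs_def]
    by (intro differentiable_mult differentiable_const differentiable_sum) (use assms in auto)
qed

section \<open>Conditional expectation given the history\<close>

lemma space_history [simp]: "space (history M x k) = space M"
  unfolding history_def by (rule space_measure_of) auto

lemma sets_history:
  "sets (history M x k)
    = sigma_sets (space M) {x j -` A \<inter> space M | j A. j \<le> k \<and> A \<in> sets borel}"
  unfolding history_def by (rule sets_measure_of) auto

lemma subalgebra_history:
  assumes "\<And>j. j \<le> k \<Longrightarrow> x j \<in> borel_measurable M"
  shows "subalgebra M (history M x k)"
  unfolding subalgebra_def sets_history using assms
  by (auto intro!: sets.sigma_sets_subset measurable_sets)

lemma measurable_history: "x k \<in> borel_measurable (history M x k)"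
  by (rule measurableI) (auto simp: sets_history intro!: sigma_sets.Basic)

section \<open>Conditioning a function of a uniform batch on a sub-sigma-algebra
  \<open>F\<close>\<close>

context sigma_finite_subalgebra
begin

text \<open>Additivity of \<open>nn_cond_exp\<close> asks for measurability only, so summands with
  infinite integral are covered.\<close>

lemma nn_cond_exp_finite_sum:
  assumes "finite I" "\<And>i. i \<in> I \<Longrightarrow> g i \<in> borel_measurable M"
  shows "AE \<omega> in M. nn_cond_exp M F (\<lambda>\<omega>. \<Sum>i\<in>I. g i \<omega>) \<omega> = (\<Sum>i\<in>I. nn_cond_exp M F (g i) \<omega>)"
  using assms
proof (induction I rule: finite_induct)
  case empty
  then show ?case
    using nn_cond_exp_F_meas[of "\<lambda>_. 0"] by simp
next
  case (insert i I)
  then have "AE \<omega> in M. nn_cond_exp M F (g i) \<omega> + nn_cond_exp M F (\<lambda>\<omega>. \<Sum>i\<in>I. g i \<omega>) \<omega>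
      = nn_cond_exp M F (\<lambda>\<omega>. g i \<omega> + (\<Sum>i\<in>I. g i \<omega>)) \<omega>"
    by (intro nn_cond_exp_sum) auto
  moreover have "AE \<omega> in M. nn_cond_exp M F (\<lambda>\<omega>. \<Sum>i\<in>I. g i \<omega>) \<omega> = (\<Sum>i\<in>I. nn_cond_exp M F (g i) \<omega>)"
    using insert by simp
  ultimately show ?case
  proof eventually_elim
    case (elim \<omega>)
    then show ?case
      using insert.hyps by simp
  qed
qed

text \<open>Translates \<open>cond_uniform_batch\<close>, stated with \<open>real_cond_exp\<close>,
  to the nonnegative setting. The negative part contributes 0, and the positive part is at most 1
  almost surely; this bound matters because \<open>enn2real\<close> sends \<open>top\<close> to
  0.\<close>

lemma nn_cond_exp_indicator:
  assumes [measurable]: "A \<in> sets M"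
  shows "AE \<omega> in M. nn_cond_exp M F (indicator A) \<omega> = ennreal (real_cond_exp M F (indicator A) \<omega>)"
proof -
  have "AE \<omega> in M. nn_cond_exp M F (indicator A) \<omega> \<le> nn_cond_exp M F (\<lambda>_. 1) \<omega>"
    by (rule nn_cond_exp_mono) (auto simp: indicator_def)
  moreover have "AE \<omega> in M. 1 = nn_cond_exp M F (\<lambda>_. 1) \<omega>"
    by (rule nn_cond_exp_F_meas) simp
  moreover have "AE \<omega> in M. 0 = nn_cond_exp M F (\<lambda>_. 0) \<omega>"
    by (rule nn_cond_exp_F_meas) simp
  moreover have "AE \<omega> in M. real_cond_exp M F (indicator A) \<omega>
      = enn2real (nn_cond_exp M F (indicator A) \<omega>) - enn2real (nn_cond_exp M F (\<lambda>_. 0) \<omega>)"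
    by (simp add: real_cond_exp_def ennreal_indicator ennreal_neg)
  ultimately show ?thesis
  proof eventually_elim
    case (elim \<omega>)
    then have "nn_cond_exp M F (indicator A) \<omega> < top"
      by (metis ennreal_one_less_top order_le_less_trans)
    with elim show ?case
      by (metis diff_zero enn2real_0 ennreal_enn2real)
  qed
qed

text \<open>Here \<open>h\<close> takes values in \<open>ennreal\<close>, so that splitting the sum
  and pulling out \<open>h B\<close> rest on measurability alone.\<close>

lemma nn_cond_exp_uniform_batch:
  assumes unif: "cond_uniform_batch M F N n T"
    and h: "\<And>B. B \<in> batches N n \<Longrightarrow> h B \<in> borel_measurable F"
  shows "AE \<omega> in M. nn_cond_exp M F (\<lambda>\<omega>. h (T \<omega>) \<omega>) \<omega>
    = (\<Sum>B\<in>batches N n. h B \<omega> * ennreal (1 / real (N choose n)))"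
proof -
  define E where "E B = {\<omega> \<in> space M. T \<omega> = B}" for B
  have T: "T \<in> measurable M (count_space (batches N n))"
    using unif by (simp add: cond_uniform_batch_def)
  have E [measurable]: "E B \<in> sets M" if "B \<in> batches N n" for B
  proof -
    have "E B = T -` {B} \<inter> space M"
      by (auto simp: E_def)
    then show ?thesis
      using measurable_sets[OF T, of "{B}"] that by simp
  qed
  have hM: "h B \<in> borel_measurable M" if "B \<in> batches N n" for B
    using measurable_from_subalg[OF subalg h[OF that]] .
  have meas: "(\<lambda>\<omega>. h B \<omega> * indicator (E B) \<omega>) \<in> borel_measurable M" if "B \<in> batches N n" for B
    using hM[OF that] E[OF that] by simp
  \<comment> \<open>Exactly one indicator is nonzero, since \<open>T \<omega>\<close> is one of the
    batches; this is known on \<open>space M\<close> only.\<close>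
  have decomp: "h (T \<omega>) \<omega> = (\<Sum>B\<in>batches N n. h B \<omega> * indicator (E B) \<omega>)" if "\<omega> \<in> space M" for \<omega>
  proof -
    have "T \<omega> \<in> batches N n"
      using measurable_space[OF T that] by simp
    moreover have "(\<Sum>B\<in>batches N n. h B \<omega> * indicator (E B) \<omega>)
        = (\<Sum>B\<in>batches N n. if T \<omega> = B then h B \<omega> else 0)"
      using that by (intro sum.cong) (auto simp: E_def)
    ultimately show ?thesis
      by simp
  qed
  have "AE \<omega> in M. nn_cond_exp M F (\<lambda>\<omega>. h (T \<omega>) \<omega>) \<omega>
      = nn_cond_exp M F (\<lambda>\<omega>. \<Sum>B\<in>batches N n. h B \<omega> * indicator (E B) \<omega>) \<omega>"
  proof (rule nn_cond_exp_cong)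
    show "(\<lambda>\<omega>. h (T \<omega>) \<omega>) \<in> borel_measurable M"
      by (rule measurable_compose_countable'[OF hM T]) (simp_all add: countable_finite[OF finite_batches])
    show "(\<lambda>\<omega>. \<Sum>B\<in>batches N n. h B \<omega> * indicator (E B) \<omega>) \<in> borel_measurable M"
      by (rule borel_measurable_sum) (rule meas)
  qed (simp add: decomp)
  moreover have "AE \<omega> in M. nn_cond_exp M F (\<lambda>\<omega>. \<Sum>B\<in>batches N n. h B \<omega> * indicator (E B) \<omega>) \<omega>
      = (\<Sum>B\<in>batches N n. nn_cond_exp M F (\<lambda>\<omega>. h B \<omega> * indicator (E B) \<omega>) \<omega>)"
    by (rule nn_cond_exp_finite_sum) (use meas in auto)
  moreover have "AE \<omega> in M. \<forall>B\<in>batches N n. nn_cond_exp M F (\<lambda>\<omega>. h B \<omega> * indicator (E B) \<omega>) \<omega>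
      = h B \<omega> * ennreal (1 / real (N choose n))"
  \<comment> \<open>Each \<open>B\<close> has its own exceptional null set; there are finitely many.
    For fixed \<open>B\<close>, the \<open>F\<close>-measurable factor \<open>h B\<close> comes out
    and leaves the conditional probability of \<open>E B\<close>.\<close>
  proof (rule AE_finite_allI)
    fix B assume B: "B \<in> batches N n"
    have "AE \<omega> in M. real_cond_exp M F (indicator (E B)) \<omega> = 1 / real (N choose n)"
      using unif B by (auto simp: cond_uniform_batch_def E_def)
    moreover have "AE \<omega> in M. h B \<omega> * nn_cond_exp M F (indicator (E B)) \<omega>
        = nn_cond_exp M F (\<lambda>\<omega>. h B \<omega> * indicator (E B) \<omega>) \<omega>"
      by (rule nn_cond_exp_prod) (use h[OF B] E[OF B] in auto)
    ultimately show "AE \<omega> in M. nn_cond_exp M F (\<lambda>\<omega>. h B \<omega> * indicator (E B) \<omega>) \<omega>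
        = h B \<omega> * ennreal (1 / real (N choose n))"
      using nn_cond_exp_indicator[OF E[OF B]] by eventually_elim simp
  qed simp
  ultimately show ?thesis
    by eventually_elim simp
qed

text \<open>
  The positive and the negative part are treated separately, since \<open>h (T \<omega>) \<omega>\<close> need not be
  integrable.
\<close>

lemma real_cond_exp_uniform_batch:
  assumes unif: "cond_uniform_batch M F N n T"
    and h: "\<And>B. B \<in> batches N n \<Longrightarrow> h B \<in> borel_measurable F"
  shows "AE \<omega> in M. real_cond_exp M F (\<lambda>\<omega>. h (T \<omega>) \<omega>) \<omega> = batch_expectation N n (\<lambda>B. h B \<omega>)"
proof -
  define c where "c = 1 / real (N choose n)"
  have "0 \<le> c"
    by (simp add: c_def)
  \<comment> \<open>\<open>ennreal\<close> truncates negative reals to 0, whence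
    \<open>max 0\<close>; the finite sum stays below \<open>top\<close>, so \<open>enn2real\<close>
    recovers its real value.\<close>
  have part: "enn2real (\<Sum>B\<in>batches N n. ennreal (g B) * ennreal c) = (\<Sum>B\<in>batches N n. max 0 (g B) * c)"
    for g :: "nat set \<Rightarrow> real"
  proof -
    have "ennreal (g B) * ennreal c = ennreal (max 0 (g B) * c)" for B
      using \<open>0 \<le> c\<close> by (simp add: ennreal_mult)
    then show ?thesis
      using \<open>0 \<le> c\<close> by (simp add: sum_ennreal sum_nonneg)
  qed
  have "AE \<omega> in M. nn_cond_exp M F (\<lambda>\<omega>. ennreal (h (T \<omega>) \<omega>)) \<omega>
      = (\<Sum>B\<in>batches N n. ennreal (h B \<omega>) * ennreal c)"
    unfolding c_def
    by (rule nn_cond_exp_uniform_batch[OF unif, where h = "\<lambda>B \<omega>. ennreal (h B \<omega>)"]) (use h in simp)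
  moreover have "AE \<omega> in M. nn_cond_exp M F (\<lambda>\<omega>. ennreal (- h (T \<omega>) \<omega>)) \<omega>
      = (\<Sum>B\<in>batches N n. ennreal (- h B \<omega>) * ennreal c)"
    unfolding c_def
    by (rule nn_cond_exp_uniform_batch[OF unif, where h = "\<lambda>B \<omega>. ennreal (- h B \<omega>)"]) (use h in simp)
  ultimately show ?thesis
  proof eventually_elim
    case (elim \<omega>)
    have "real_cond_exp M F (\<lambda>\<omega>. h (T \<omega>) \<omega>) \<omega>
        = (\<Sum>B\<in>batches N n. max 0 (h B \<omega>) * c - max 0 (- h B \<omega>) * c)"
      by (simp add: real_cond_exp_def elim part sum_subtractf)
    \<comment> \<open>Positive part minus negative part gives back
      \<open>h B \<omega>\<close>.\<close>
    also have "\<dots> = (\<Sum>B\<in>batches N n. c * h B \<omega>)"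
      by (intro sum.cong) (auto simp: max_def)
    finally show ?case
      by (simp add: batch_expectation_def c_def sum_distrib_left)
  qed
qed

text \<open>The scalar result holds for each of the finitely many coordinates, and the union of
  their exceptional sets is still null.\<close>

lemma vec_cond_exp_uniform_batch:
  fixes h :: "nat set \<Rightarrow> 'a \<Rightarrow> real ^ 'd"
  assumes unif: "cond_uniform_batch M F N n T"
    and h: "\<And>B. B \<in> batches N n \<Longrightarrow> h B \<in> borel_measurable F"
  shows "AE \<omega> in M. vec_cond_exp M F (\<lambda>\<omega>. h (T \<omega>) \<omega>) \<omega> = batch_expectation N n (\<lambda>B. h B \<omega>)"
proof -
  have "AE \<omega> in M. \<forall>j\<in>UNIV. real_cond_exp M F (\<lambda>\<omega>. h (T \<omega>) \<omega> $ j) \<omega>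
      = batch_expectation N n (\<lambda>B. h B \<omega> $ j)"
  proof (rule AE_finite_allI)
    fix j :: 'd
    have "(\<lambda>\<omega>. h B \<omega> $ j) \<in> borel_measurable F" if "B \<in> batches N n" for B
      using h[OF that] by (rule measurable_compose) (intro borel_measurable_continuous_onI continuous_intros)
    then show "AE \<omega> in M. real_cond_exp M F (\<lambda>\<omega>. h (T \<omega>) \<omega> $ j) \<omega>
        = batch_expectation N n (\<lambda>B. h B \<omega> $ j)"
      by (rule real_cond_exp_uniform_batch[OF unif, where h = "\<lambda>B \<omega>. h B \<omega> $ j"])
  qed simp
  then show ?thesis
    by eventually_elim (simp add: vec_cond_exp_def batch_expectation_def vec_eq_iff)
qed

end

section \<open>Conditional mean and variance along the iterates\<close>

theorem proposition2p2:
  fixes M :: "'w measure"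
    and f :: "nat \<Rightarrow> real ^ 'd \<Rightarrow> real"
    and N :: nat
    and N\<^sub>S :: "nat \<Rightarrow> nat"
    and \<alpha> :: "nat \<Rightarrow> real"
    and S :: "nat \<Rightarrow> 'w \<Rightarrow> nat set"
    and x :: "nat \<Rightarrow> 'w \<Rightarrow> real ^ 'd"
  assumes "prob_space M"
    and "\<And>i y. i \<in> {1..N} \<Longrightarrow> f i differentiable (at y)"
    and "\<And>k. 1 \<le> N\<^sub>S k \<and> N\<^sub>S k < N"
    and "x 0 \<in> borel_measurable M"
    and "\<And>k \<omega>. \<omega> \<in> space M \<Longrightarrow>
           x (Suc k) \<omega> = x k \<omega> - \<alpha> k *\<^sub>R batch_gradient f (S k \<omega>) (x k \<omega>)"
    and "\<And>k. cond_uniform_batch M (history M x k) N (N\<^sub>S k) (S k)"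
  shows "\<forall>k. AE \<omega> in M.
      vec_cond_exp M (history M x k) (\<lambda>\<omega>'. batch_gradient f (S k \<omega>') (x k \<omega>')) \<omega>
        = batch_expectation N (N\<^sub>S k) (\<lambda>B. batch_gradient f B (x k \<omega>))
      \<and> batch_expectation N (N\<^sub>S k) (\<lambda>B. batch_gradient f B (x k \<omega>))
        = gradient (objective N f) (x k \<omega>)
      \<and> cond_variance_about M (history M x k)
          (\<lambda>\<omega>'. batch_gradient f (S k \<omega>') (x k \<omega>'))
          (\<lambda>\<omega>'. gradient (objective N f) (x k \<omega>')) \<omega>
        = batch_expectation N (N\<^sub>S k)
            (\<lambda>B. (norm (batch_gradient f B (x k \<omega>) - gradient (objective N f) (x k \<omega>)))\<^sup>2)
      \<and> batch_expectation N (N\<^sub>S k)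
            (\<lambda>B. (norm (batch_gradient f B (x k \<omega>) - gradient (objective N f) (x k \<omega>)))\<^sup>2)
        = component_variance N f (x k \<omega>) / real (N\<^sub>S k)
            * ((real N - real (N\<^sub>S k)) / (real N - 1))"
proof
  fix k
  interpret prob_space M by fact
  have n: "1 \<le> N\<^sub>S k" "N\<^sub>S k < N" for k
    using assms(3) by auto
  have T: "S k \<in> measurable M (count_space (batches N (N\<^sub>S k)))" for k
    using assms(6) by (simp add: cond_uniform_batch_def)
  note bg = borel_measurable_batch_gradient[OF assms(2)]
  \<comment> \<open>Measurability propagates from \<open>x 0\<close> through the update rule: the
    batch takes finitely many values, and for each fixed batch the gradient estimate is a Borel
    function of the iterate.\<close>
  have x: "x j \<in> borel_measurable M" for j
  proof (induction j)
    case (Suc j)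
    have "(\<lambda>\<omega>. batch_gradient f (S j \<omega>) (x j \<omega>)) \<in> borel_measurable M"
    proof (rule measurable_compose_countable'[OF _ T])
      show "(\<lambda>\<omega>. batch_gradient f B (x j \<omega>)) \<in> borel_measurable M"
        if "B \<in> batches N (N\<^sub>S j)" for B
        by (rule measurable_compose[OF Suc bg[OF _ that]])
    qed (rule countable_finite[OF finite_batches])
    then have "(\<lambda>\<omega>. x j \<omega> - \<alpha> j *\<^sub>R batch_gradient f (S j \<omega>) (x j \<omega>)) \<in> borel_measurable M"
      using Suc by simp
    then show ?case
      using assms(5) by (subst measurable_cong) auto
  qed (fact assms(4))
  define F where "F = history M x k"
  \<comment> \<open>A probability measure is finite on every subalgebra, which makes the
    conditioning lemmas available for the history \<open>F\<close>.\<close>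
  interpret finite_measure_subalgebra M F
    by standard (simp add: F_def subalgebra_history x)
  have xF: "x k \<in> borel_measurable F"
    unfolding F_def by (rule measurable_history)
  have unif: "cond_uniform_batch M F N (N\<^sub>S k) (S k)"
    unfolding F_def by (rule assms(6))
  have bgF: "(\<lambda>\<omega>. batch_gradient f B (x k \<omega>)) \<in> borel_measurable F"
    if "B \<in> batches N (N\<^sub>S k)" for B
    by (rule measurable_compose[OF xF bg[OF _ that]])
  have gF: "(\<lambda>\<omega>. gradient (objective N f) (x k \<omega>)) \<in> borel_measurable F"
    by (rule measurable_compose[OF xF borel_measurable_gradient_objective[OF assms(2)]])
  \<comment> \<open>This and the variance formula hold at every point \<open>y\<close>, hence at
    \<open>x k \<omega>\<close> for every \<open>\<omega>\<close>; only the conditional expectations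
    bring in null sets.\<close>
  have mean: "batch_expectation N (N\<^sub>S k) (\<lambda>B. batch_gradient f B y) = gradient (objective N f) y" for y
    by (rule batch_expectation_batch_gradient) (use assms(2) n less_imp_le[OF n(2)] in auto)
  have variance: "batch_expectation N (N\<^sub>S k)
        (\<lambda>B. (norm (batch_gradient f B y - gradient (objective N f) y))\<^sup>2)
      = component_variance N f y / real (N\<^sub>S k) * ((real N - real (N\<^sub>S k)) / (real N - 1))" for y
    by (rule batch_expectation_variance) (use assms(2) n in auto)
  have "AE \<omega> in M. vec_cond_exp M F (\<lambda>\<omega>'. batch_gradient f (S k \<omega>') (x k \<omega>')) \<omega>
      = batch_expectation N (N\<^sub>S k) (\<lambda>B. batch_gradient f B (x k \<omega>))"
    by (rule vec_cond_exp_uniform_batch[OF unif, where h = "\<lambda>B \<omega>. batch_gradient f B (x k \<omega>)"])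
      (rule bgF)
  \<comment> \<open>The centre depends on \<open>\<omega>\<close> through \<open>x k\<close> only,
    so it is \<open>F\<close>-measurable and can be absorbed into \<open>h B\<close>.\<close>
  moreover have "AE \<omega> in M. cond_variance_about M F
      (\<lambda>\<omega>'. batch_gradient f (S k \<omega>') (x k \<omega>')) (\<lambda>\<omega>'. gradient (objective N f) (x k \<omega>')) \<omega>
      = batch_expectation N (N\<^sub>S k)
          (\<lambda>B. (norm (batch_gradient f B (x k \<omega>) - gradient (objective N f) (x k \<omega>)))\<^sup>2)"
    unfolding cond_variance_about_def
    by (rule real_cond_exp_uniform_batch[OF unif, where
          h = "\<lambda>B \<omega>. (norm (batch_gradient f B (x k \<omega>) - gradient (objective N f) (x k \<omega>)))\<^sup>2"])
      (use bgF gF in simp)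
  ultimately show "AE \<omega> in M.
      vec_cond_exp M (history M x k) (\<lambda>\<omega>'. batch_gradient f (S k \<omega>') (x k \<omega>')) \<omega>
        = batch_expectation N (N\<^sub>S k) (\<lambda>B. batch_gradient f B (x k \<omega>))
      \<and> batch_expectation N (N\<^sub>S k) (\<lambda>B. batch_gradient f B (x k \<omega>))
        = gradient (objective N f) (x k \<omega>)
      \<and> cond_variance_about M (history M x k)
          (\<lambda>\<omega>'. batch_gradient f (S k \<omega>') (x k \<omega>'))
          (\<lambda>\<omega>'. gradient (objective N f) (x k \<omega>')) \<omega>
        = batch_expectation N (N\<^sub>S k)
            (\<lambda>B. (norm (batch_gradient f B (x k \<omega>) - gradient (objective N f) (x k \<omega>)))\<^sup>2)
      \<and> batch_expectation N (N\<^sub>S k)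
            (\<lambda>B. (norm (batch_gradient f B (x k \<omega>) - gradient (objective N f) (x k \<omega>)))\<^sup>2)
        = component_variance N f (x k \<omega>) / real (N\<^sub>S k)
            * ((real N - real (N\<^sub>S k)) / (real N - 1))"
    unfolding F_def[symmetric] by eventually_elim (simp only: mean variance simp_thms)
qed

end
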